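(* Let $v>0$. Suppose that $E e^{u\eta_1}<\infty$ for all $0\le u<\infty$, that $$E\log(1+|\eta_1|)<\infty,$$ and that $$\int_1^\infty e^{uy-\phi(u)}u^{v-1}\,du<\infty\quad\text{for every } y\in D.$$ Set $$N_v(y)=\int_0^\infty e^{uy-\phi(u)}u^{v-1}\,du,\quad y\in D.$$ Then the process $\lambda^{vn}N_v(X_n)$, $n=0,1,2,\dots$, is a martingale with respect to the filtration $\mathcal{F}_n=\sigma\{X_0,X_1,\dots,X_n\}$.
   Context: Let $\{\eta_n\}_{n\ge 1}$ be a sequence of independent identically distributed real random variables, and let $\lambda$ and $x$ be nonrandom real constants with $0<\lambda<1$. The AR(1) sequence $(X_n)_{n\ge 0}$ is defined by $X_0=x$ and $X_n=\lambda X_{n-1}+\eta_n$ for $n=1,2,\dots$. The set $D\subset\mathbb{R}$ denotes the domain (state space) of the process, i.e. the set of values taken by $X_n$, $n=0,1,2,\dots$ (so $x\in D$ and $X_n\in D$ almost surely for all $n$). The cumulant function of $\eta_1$ is $\psi(u)=\log E e^{u\eta_1}$, $0\le u<\infty$, and $\phi(u)=\sum_{k=0}^\infty\psi(\lambda^k u)$, $0\le u<\infty$ (this series converges to a finite value when $E e^{u\eta_1}<\infty$ for all $u\ge0$ and $E\log(1+|\eta_1|)<\infty$). *)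

theory Defs
  imports "HOL-Probability.Probability"
begin

text \<open>
  The innovations are a function on \<open>nat\<close>, of which only the values at indices \<open>n \<ge> 1\<close> are used.
\<close>

primrec ar1 :: "real \<Rightarrow> real \<Rightarrow> (nat \<Rightarrow> 'a \<Rightarrow> real) \<Rightarrow> nat \<Rightarrow> 'a \<Rightarrow> real" where
  "ar1 lam x \<eta> 0 = (\<lambda>\<omega>. x)"
| "ar1 lam x \<eta> (Suc n) = (\<lambda>\<omega>. lam * ar1 lam x \<eta> n \<omega> + \<eta> (Suc n) \<omega>)"

definition cumulant :: "'a measure \<Rightarrow> ('a \<Rightarrow> real) \<Rightarrow> real \<Rightarrow> real" where
  "cumulant M Y u = ln (LINT \<omega>|M. exp (u * Y \<omega>))"

definition cumulant_series :: "real \<Rightarrow> 'a measure \<Rightarrow> ('a \<Rightarrow> real) \<Rightarrow> real \<Rightarrow> real" where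
  "cumulant_series lam M Y u = (\<Sum>k. cumulant M Y (lam ^ k * u))"

text \<open>
  The Bochner integral is \<open>0\<close> where the integrand is not integrable, so \<open>N_fun \<phi> v y\<close> has the
  intended meaning only for those \<open>y\<close> at which the integral converges.
\<close>

definition N_integrand :: "(real \<Rightarrow> real) \<Rightarrow> real \<Rightarrow> real \<Rightarrow> real \<Rightarrow> real" where
  "N_integrand \<phi> v y u = exp (u * y - \<phi> u) * u powr (v - 1)"

definition N_fun :: "(real \<Rightarrow> real) \<Rightarrow> real \<Rightarrow> real \<Rightarrow> real" where
  "N_fun \<phi> v y = (LINT u:{0<..}|lborel. N_integrand \<phi> v y u)"

definition natural_filtration :: "'a measure \<Rightarrow> (nat \<Rightarrow> 'a \<Rightarrow> real) \<Rightarrow> nat \<Rightarrow> 'a measure" where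
  "natural_filtration M X n =
     sigma (space M) {X i -` A \<inter> space M | i A. i \<le> n \<and> A \<in> sets borel}"

definition martingale ::
    "'a measure \<Rightarrow> (nat \<Rightarrow> 'a measure) \<Rightarrow> (nat \<Rightarrow> 'a \<Rightarrow> real) \<Rightarrow> bool" where
  "martingale M F Y \<longleftrightarrow>
     filtration (space M) F \<and> (\<forall>n. subalgebra M (F n)) \<and>
     (\<forall>n. Y n \<in> borel_measurable (F n)) \<and>
     (\<forall>n. integrable M (Y n)) \<and>
     (\<forall>m n. m \<le> n \<longrightarrow> (AE \<omega> in M. real_cond_exp M (F m) (Y n) \<omega> = Y m \<omega>))"

end

theory Submission
  imports Defs
begin

text \<open>
  The weights in \<open>\<phi>(u) = \<Sum>k. \<psi>(\<lambda>\<^sup>k u)\<close> are chosen so that \<open>\<psi>(u) - \<phi>(u) = - \<phi>(\<lambda>u)\<close>. One step of the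
  recursion maps \<open>y\<close> to \<open>\<lambda>y + \<eta>\<close>, and by Tonelli
  \<open>E N(\<lambda>y + \<eta>) = \<integral> e\<^bsup>u\<lambda>y + \<psi>(u) - \<phi>(u)\<^esup> u\<^bsup>v-1\<^esup> du = \<integral> e\<^bsup>\<lambda>uy - \<phi>(\<lambda>u)\<^esup> u\<^bsup>v-1\<^esup> du = \<lambda>\<^bsup>-v\<^esup> N(y)\<close>,
  the last equality being the substitution \<open>t = \<lambda>u\<close> (\<open>nn_integral_N_nn_step\<close>). The Markov property of
  the autoregression (\<open>ar1_markov\<close>) turns this into the martingale property.

  All integrals are nonnegative, so the computation is carried out for the extended nonnegative
  function \<open>N_nn\<close>, for which it is valid at every real \<open>y\<close>. Integrability of the process then follows
  from \<open>N_nn \<phi> v x < \<infinity>\<close> at the starting point alone, since the expectation is conserved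
  (\<open>martingale_enn2real\<close>).

  Two facts about \<open>\<phi>\<close> carry analytic content: the series converges, which gives the recursion
  \<open>\<phi>(u) = \<psi>(u) + \<phi>(\<lambda>u)\<close>, and \<open>\<phi>\<close> is bounded below on \<open>[0, 1]\<close>, which makes the integrand of \<open>N\<close>
  integrable near \<open>0\<close>. For the positive side of \<open>\<psi>\<close>, convexity of \<open>exp\<close> gives
  \<open>\<psi>(\<lambda>\<^sup>k u) \<le> \<lambda>\<^sup>k E e\<^bsup>u\<eta>\<^esup>\<close>. For the negative side, with \<open>z\<^sub>k = E e\<^bsup>-\<lambda>\<^sup>k w|\<eta>|\<^esup>\<close> and \<open>u \<le> w\<close>,
  \<open>\<psi>(\<lambda>\<^sup>k u) \<ge> ln z\<^sub>k \<ge> - (1 - z\<^sub>k) / z\<^sub>0\<close>, a bound uniform in \<open>u\<close>, and \<open>\<Sum>k. 1 - z\<^sub>k\<close> is finite by the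
  logarithmic moment, because \<open>\<Sum>k. 1 - e\<^bsup>-\<lambda>\<^sup>k t\<^esup>\<close> grows at most like \<open>ln (1 + t)\<close>.
\<close>

section \<open>The cumulant series\<close>

text \<open>
  The right-hand side is a difference between the arguments \<open>t\<close> and \<open>q t\<close>, so that the bound telescopes
  when it is summed over \<open>t, q t, q\<^sup>2 t, \<dots>\<close>. Both sides are compared with \<open>t / (1 + t)\<close>.
\<close>

lemma one_minus_exp_le_ln_diff:
  fixes t q :: real
  assumes "0 \<le> t" "0 < q" "q < 1"
  shows "1 - exp (- t) \<le> 2 / (1 - q) * (ln (1 + t) - ln (1 + q * t))"
proof -
  have "1 - exp (- t) \<le> 2 * (t / (1 + t))"
  proof (cases "t \<le> 1")
    case True
    have "1 - exp (- t) \<le> t"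
      using exp_ge_add_one_self[of "- t"] by simp
    also have "t \<le> 2 * (t / (1 + t))"
      using True assms mult_left_mono[of t 1 t] by (simp add: field_simps)
    finally show ?thesis .
  next
    case False
    have "1 - exp (- t) \<le> 1" by simp
    also have "1 \<le> 2 * (t / (1 + t))"
      using False by (simp add: field_simps)
    finally show ?thesis .
  qed
  moreover
  have "(1 - q) * (t / (1 + t)) \<le> ln (1 + t) - ln (1 + q * t)"
  proof -
    have pos: "0 < 1 + t" "0 < 1 + q * t"
      using assms by (auto intro: add_pos_nonneg)
    have "ln ((1 + q * t) / (1 + t)) \<le> (1 + q * t) / (1 + t) - 1"
      using pos by (intro ln_le_minus_one) simp
    also have "\<dots> = - ((1 - q) * (t / (1 + t)))"
      using pos by (simp add: field_simps)
    finally show ?thesis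
      using pos by (simp add: ln_div)
  qed
  then have "t / (1 + t) \<le> (ln (1 + t) - ln (1 + q * t)) / (1 - q)"
    using assms by (simp add: pos_le_divide_eq mult.commute)
  then have "2 * (t / (1 + t)) \<le> 2 / (1 - q) * (ln (1 + t) - ln (1 + q * t))"
    using mult_left_mono[of _ _ "2 :: real"]
    by (simp only: times_divide_eq_left times_divide_eq_right zero_le_numeral)
  ultimately show ?thesis by linarith
qed

lemma sum_one_minus_exp_le:
  fixes t q :: real
  assumes "0 \<le> t" "0 < q" "q < 1"
  shows "(\<Sum>k<n. 1 - exp (- (q ^ k * t))) \<le> 2 / (1 - q) * ln (1 + t)"
proof -
  have "(\<Sum>k<n. 1 - exp (- (q ^ k * t)))
      \<le> (\<Sum>k<n. 2 / (1 - q) * (ln (1 + q ^ k * t) - ln (1 + q ^ Suc k * t)))"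
    using one_minus_exp_le_ln_diff[of "q ^ k * t" q for k] assms
    by (intro sum_mono) (simp add: mult.assoc)
  also have "\<dots> = 2 / (1 - q) * (ln (1 + t) - ln (1 + q ^ n * t))"
    using sum_lessThan_telescope'[of "\<lambda>k. ln (1 + q ^ k * t)" n]
    by (simp only: sum_distrib_left[symmetric]) simp
  also have "\<dots> \<le> 2 / (1 - q) * ln (1 + t)"
    using assms by (intro mult_left_mono) auto
  finally show ?thesis .
qed

context prob_space
begin

lemma integrable_exp_neg_abs:
  assumes [measurable]: "random_variable borel Y" and "0 \<le> (c::real)"
  shows "integrable M (\<lambda>\<omega>. exp (- (c * \<bar>Y \<omega>\<bar>)))"
  using assms(2) by (intro integrable_const_bound[where B = 1]) auto

lemma expectation_exp_pos:
  assumes "integrable M (\<lambda>\<omega>. exp (f \<omega> :: real))"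
  shows "0 < expectation (\<lambda>\<omega>. exp (f \<omega>))"
proof -
  have "expectation (\<lambda>\<omega>. exp (f \<omega>)) \<noteq> 0"
    using assms by (subst integral_nonneg_eq_0_iff_AE) (auto simp: AE_False emeasure_space_1)
  moreover have "0 \<le> expectation (\<lambda>\<omega>. exp (f \<omega>))"
    by simp
  ultimately show ?thesis by linarith
qed

lemma summable_expectation_one_minus_exp:
  fixes Y :: "'a \<Rightarrow> real"
  assumes Y [measurable]: "random_variable borel Y"
    and log: "integrable M (\<lambda>\<omega>. ln (1 + \<bar>Y \<omega>\<bar>))"
    and q: "0 < q" "q < 1" and w: "0 \<le> w"
  shows "summable (\<lambda>k. expectation (\<lambda>\<omega>. 1 - exp (- (q ^ k * w * \<bar>Y \<omega>\<bar>))))"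
proof (rule bounded_imp_summable)
  have int: "integrable M (\<lambda>\<omega>. 1 - exp (- (q ^ k * w * \<bar>Y \<omega>\<bar>)))" for k
    using integrable_exp_neg_abs[OF Y, of "q ^ k * w"] q w by simp
  show "0 \<le> expectation (\<lambda>\<omega>. 1 - exp (- (q ^ k * w * \<bar>Y \<omega>\<bar>)))" for k
    using q w by (intro integral_nonneg_AE) simp
  show "(\<Sum>k\<le>n. expectation (\<lambda>\<omega>. 1 - exp (- (q ^ k * w * \<bar>Y \<omega>\<bar>))))
      \<le> expectation (\<lambda>\<omega>. 2 / (1 - q) * (ln (1 + w) + ln (1 + \<bar>Y \<omega>\<bar>)))" for n
  proof -
    have "(\<Sum>k\<le>n. 1 - exp (- (q ^ k * w * \<bar>Y \<omega>\<bar>))) \<le> 2 / (1 - q) * (ln (1 + w) + ln (1 + \<bar>Y \<omega>\<bar>))" for \<omega>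
    proof -
      have "(\<Sum>k\<le>n. 1 - exp (- (q ^ k * w * \<bar>Y \<omega>\<bar>))) \<le> 2 / (1 - q) * ln (1 + w * \<bar>Y \<omega>\<bar>)"
        using sum_one_minus_exp_le[of "w * \<bar>Y \<omega>\<bar>" q "Suc n"] q w
        by (simp add: lessThan_Suc_atMost mult.assoc)
      also have "ln (1 + w * \<bar>Y \<omega>\<bar>) \<le> ln ((1 + w) * (1 + \<bar>Y \<omega>\<bar>))"
        using w by (subst ln_le_cancel_iff) (auto simp: algebra_simps intro: add_pos_nonneg)
      also have "\<dots> = ln (1 + w) + ln (1 + \<bar>Y \<omega>\<bar>)"
        using w by (subst ln_mult) auto
      finally show ?thesis
        using q by (simp add: mult_left_mono divide_right_mono)
    qed
    then have "expectation (\<lambda>\<omega>. \<Sum>k\<le>n. 1 - exp (- (q ^ k * w * \<bar>Y \<omega>\<bar>)))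
        \<le> expectation (\<lambda>\<omega>. 2 / (1 - q) * (ln (1 + w) + ln (1 + \<bar>Y \<omega>\<bar>)))"
      using int log by (intro integral_mono Bochner_Integration.integrable_sum) auto
    then show ?thesis
      using int by (subst (asm) Bochner_Integration.integral_sum) auto
  qed
qed

text \<open>
  The bound depends on \<open>w\<close> but not on \<open>u\<close>. It thus serves both for convergence of the cumulant series
  and for a lower bound on the sum that is uniform over \<open>[0, w]\<close>.
\<close>

lemma cumulant_lower_bound:
  fixes Y :: "'a \<Rightarrow> real"
  assumes Y [measurable]: "random_variable borel Y"
    and exp: "\<And>u. 0 \<le> u \<Longrightarrow> integrable M (\<lambda>\<omega>. exp (u * Y \<omega>))"
    and q: "0 < q" "q < 1" and u: "0 \<le> u" "u \<le> w"
  shows "- (expectation (\<lambda>\<omega>. 1 - exp (- (q ^ k * w * \<bar>Y \<omega>\<bar>))) / expectation (\<lambda>\<omega>. exp (- (w * \<bar>Y \<omega>\<bar>))))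
         \<le> cumulant M Y (q ^ k * u)"
proof -
  define z where "z = expectation (\<lambda>\<omega>. exp (- (q ^ k * w * \<bar>Y \<omega>\<bar>)))"
  define z0 where "z0 = expectation (\<lambda>\<omega>. exp (- (w * \<bar>Y \<omega>\<bar>)))"
  have w: "0 \<le> w" "0 \<le> q ^ k * w" using u q by auto
  note ints = integrable_exp_neg_abs[OF Y w(1)] integrable_exp_neg_abs[OF Y w(2)]
  have pos: "0 < z" "0 < z0"
    unfolding z_def z0_def by (intro expectation_exp_pos ints)+
  have "q ^ k \<le> 1" using q by (simp add: power_le_one)
  then have le1: "q ^ k * w * \<bar>Y \<omega>\<bar> \<le> w * \<bar>Y \<omega>\<bar>" for \<omega>
    using w mult_right_mono[of "q ^ k" 1 "w * \<bar>Y \<omega>\<bar>"] by (simp add: mult.assoc)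
  have z0: "z0 \<le> z"
    unfolding z_def z0_def using le1 by (intro integral_mono ints) simp
  have z1: "z \<le> 1"
    unfolding z_def using ints(2) w by (intro integral_le_const) auto
  have le2: "- (q ^ k * w * \<bar>Y \<omega>\<bar>) \<le> q ^ k * u * Y \<omega>" for \<omega>
  proof -
    have "q ^ k * u * (- Y \<omega>) \<le> q ^ k * u * \<bar>Y \<omega>\<bar>"
      using q u by (intro mult_left_mono) auto
    also have "\<dots> \<le> q ^ k * w * \<bar>Y \<omega>\<bar>"
      using q u by (intro mult_right_mono mult_left_mono) auto
    finally show ?thesis by simp
  qed
  have zz: "z \<le> expectation (\<lambda>\<omega>. exp (q ^ k * u * Y \<omega>))"
    unfolding z_def using le2 q u by (intro integral_mono ints exp) simp_all
  \<comment> \<open>From \<open>ln (1 / z) \<le> 1 / z - 1\<close>; the denominator is then replaced by \<open>z0\<close>, which is free of \<open>k\<close>.\<close>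
  have "- ((1 - z) / z0) \<le> - ((1 - z) / z)"
    using pos z0 z1 by (simp add: frac_le)
  also have "\<dots> \<le> ln z"
    using ln_le_minus_one[of "1 / z"] pos by (simp add: ln_div field_simps)
  also have "\<dots> \<le> cumulant M Y (q ^ k * u)"
    unfolding cumulant_def using zz pos by simp
  also have "1 - z = expectation (\<lambda>\<omega>. 1 - exp (- (q ^ k * w * \<bar>Y \<omega>\<bar>)))"
    unfolding z_def using ints(2) by (subst Bochner_Integration.integral_diff) (auto simp: prob_space)
  finally show ?thesis
    unfolding z0_def .
qed

lemma cumulant_upper_bound:
  fixes Y :: "'a \<Rightarrow> real"
  assumes exp: "\<And>u. 0 \<le> u \<Longrightarrow> integrable M (\<lambda>\<omega>. exp (u * Y \<omega>))"
    and s: "0 \<le> s" "s \<le> 1" and u: "0 \<le> u"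
  shows "cumulant M Y (s * u) \<le> s * expectation (\<lambda>\<omega>. exp (u * Y \<omega>))"
proof -
  have conv: "exp (s * u * Y \<omega>) \<le> (1 - s) + s * exp (u * Y \<omega>)" for \<omega>
    using convex_onD[OF exp_convex s, of 0 "u * Y \<omega>"] by (simp add: mult.assoc)
  have su: "0 \<le> s * u" using s u by simp
  have "cumulant M Y (s * u) \<le> expectation (\<lambda>\<omega>. exp (s * u * Y \<omega>)) - 1"
    unfolding cumulant_def by (intro ln_le_minus_one expectation_exp_pos exp su)
  also have "expectation (\<lambda>\<omega>. exp (s * u * Y \<omega>)) \<le> expectation (\<lambda>\<omega>. (1 - s) + s * exp (u * Y \<omega>))"
    using conv exp[OF u] exp[OF su] by (intro integral_mono) auto
  also have "\<dots> = (1 - s) + s * expectation (\<lambda>\<omega>. exp (u * Y \<omega>))"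
    using exp[OF u] by (simp add: prob_space)
  finally show ?thesis using s by simp
qed

lemma summable_cumulant:
  fixes Y :: "'a \<Rightarrow> real"
  assumes Y [measurable]: "random_variable borel Y"
    and exp: "\<And>u. 0 \<le> u \<Longrightarrow> integrable M (\<lambda>\<omega>. exp (u * Y \<omega>))"
    and log: "integrable M (\<lambda>\<omega>. ln (1 + \<bar>Y \<omega>\<bar>))"
    and q: "0 < q" "q < 1" and u: "0 \<le> u"
  shows "summable (\<lambda>k. cumulant M Y (q ^ k * u))"
proof (rule summable_comparison_test)
  let ?a = "\<lambda>k. q ^ k * expectation (\<lambda>\<omega>. exp (u * Y \<omega>))"
  let ?b = "\<lambda>k. expectation (\<lambda>\<omega>. 1 - exp (- (q ^ k * u * \<bar>Y \<omega>\<bar>))) / expectation (\<lambda>\<omega>. exp (- (u * \<bar>Y \<omega>\<bar>)))"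
  have "norm (cumulant M Y (q ^ k * u)) \<le> ?a k + ?b k" for k
  proof -
    have "0 \<le> ?a k" "0 \<le> ?b k"
      using q u by (auto intro!: mult_nonneg_nonneg divide_nonneg_nonneg integral_nonneg_AE)
    moreover have "- ?b k \<le> cumulant M Y (q ^ k * u)"
      using cumulant_lower_bound[OF Y exp q u order_refl] .
    moreover have "cumulant M Y (q ^ k * u) \<le> ?a k"
      using cumulant_upper_bound[OF exp _ _ u, of "q ^ k"] q by (simp add: power_le_one)
    ultimately show ?thesis by (simp add: abs_le_iff)
  qed
  then show "\<exists>N. \<forall>k\<ge>N. norm (cumulant M Y (q ^ k * u)) \<le> ?a k + ?b k" by blast
  show "summable (\<lambda>k. ?a k + ?b k)"
    using q by (intro summable_add summable_divide summable_mult2 summable_geometric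
        summable_expectation_one_minus_exp[OF Y log q u]) auto
qed

lemma cumulant_series_rec:
  fixes Y :: "'a \<Rightarrow> real"
  assumes "random_variable borel Y"
    and "\<And>u. 0 \<le> u \<Longrightarrow> integrable M (\<lambda>\<omega>. exp (u * Y \<omega>))"
    and "integrable M (\<lambda>\<omega>. ln (1 + \<bar>Y \<omega>\<bar>))"
    and "0 < q" "q < 1" "0 \<le> u"
  shows "cumulant_series q M Y u = cumulant M Y u + cumulant_series q M Y (q * u)"
  using suminf_split_head[OF summable_cumulant[OF assms]]
  by (simp add: cumulant_series_def mult_ac)

lemma cumulant_series_bounded_below:
  fixes Y :: "'a \<Rightarrow> real"
  assumes Y: "random_variable borel Y"
    and exp: "\<And>u. 0 \<le> u \<Longrightarrow> integrable M (\<lambda>\<omega>. exp (u * Y \<omega>))"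
    and log: "integrable M (\<lambda>\<omega>. ln (1 + \<bar>Y \<omega>\<bar>))"
    and q: "0 < q" "q < 1"
  obtains C where "\<And>u. 0 \<le> u \<Longrightarrow> u \<le> w \<Longrightarrow> C \<le> cumulant_series q M Y u"
proof (cases "0 \<le> w")
  case True
  let ?b = "\<lambda>k. - (expectation (\<lambda>\<omega>. 1 - exp (- (q ^ k * w * \<bar>Y \<omega>\<bar>))) / expectation (\<lambda>\<omega>. exp (- (w * \<bar>Y \<omega>\<bar>))))"
  have "(\<Sum>k. ?b k) \<le> cumulant_series q M Y u" if "0 \<le> u" "u \<le> w" for u
    unfolding cumulant_series_def
    by (intro suminf_le cumulant_lower_bound[OF Y exp q that] summable_cumulant[OF Y exp log q that(1)]
        summable_minus summable_divide summable_expectation_one_minus_exp[OF Y log q True])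
  then show ?thesis by (rule that)
next
  case False
  show ?thesis using that[of 0] False by simp
qed

lemma borel_measurable_cumulant_series:
  fixes Y :: "'a \<Rightarrow> real"
  assumes [measurable]: "random_variable borel Y"
  shows "cumulant_series q M Y \<in> borel_measurable borel"
proof -
  have [measurable]: "cumulant M Y \<in> borel_measurable borel"
    unfolding cumulant_def[abs_def] by measurable
  show ?thesis
    unfolding cumulant_series_def[abs_def] by measurable
qed

end

section \<open>The function \<open>N\<close> as a nonnegative integral\<close>

text \<open>
  The integral defining \<open>N_fun\<close> with values in the extended nonnegative reals: it is \<open>\<infinity>\<close> where the
  integral diverges, whereas \<open>N_fun\<close> is \<open>0\<close> there.
\<close>

definition N_nn :: "(real \<Rightarrow> real) \<Rightarrow> real \<Rightarrow> real \<Rightarrow> ennreal" where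
  "N_nn \<phi> v y = (\<integral>\<^sup>+u. ennreal (indicator {0<..} u * N_integrand \<phi> v y u) \<partial>lborel)"

lemma borel_measurable_N_integrand [measurable (raw)]:
  assumes [measurable]: "\<phi> \<in> borel_measurable borel" "f \<in> borel_measurable M" "g \<in> borel_measurable M"
  shows "(\<lambda>x. N_integrand \<phi> v (f x) (g x)) \<in> borel_measurable M"
  unfolding N_integrand_def by measurable

lemma borel_measurable_N_nn:
  assumes [measurable]: "\<phi> \<in> borel_measurable borel"
  shows "N_nn \<phi> v \<in> borel_measurable borel"
  unfolding N_nn_def[abs_def] by measurable

lemma N_fun_eq_N_nn:
  assumes [measurable]: "\<phi> \<in> borel_measurable borel"
  shows "N_fun \<phi> v y = enn2real (N_nn \<phi> v y)"
  unfolding N_fun_def N_nn_def set_lebesgue_integral_def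
  by (subst integral_eq_nn_integral) (auto simp: N_integrand_def)

lemma N_nn_finite:
  assumes [measurable]: "\<phi> \<in> borel_measurable borel"
    and v: "0 < v"
    and bdd: "\<And>u. 0 \<le> u \<Longrightarrow> u \<le> 1 \<Longrightarrow> C \<le> \<phi> u"
    and int: "set_integrable lborel {1..} (N_integrand \<phi> v y)"
  shows "N_nn \<phi> v y < \<infinity>"
proof -
  have "(\<lambda>u::real. u powr (v - 1)) absolutely_integrable_on {0..1}"
    using v by (intro nonnegative_absolutely_integrable_1 integrable_on_powr_from_0) auto
  then have "set_integrable lborel {0..1} (\<lambda>u::real. u powr (v - 1))"
    unfolding set_integrable_def by (subst (asm) integrable_completion) auto
  then have "set_integrable lborel {0..1} (\<lambda>u::real. exp (\<bar>y\<bar> - C) * u powr (v - 1))"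
    by (rule set_integrable_mult_right)
  then have "set_integrable lborel {0..1} (N_integrand \<phi> v y)"
  proof (rule set_integrable_bound)
    show "set_borel_measurable lborel {0..1} (N_integrand \<phi> v y)"
      unfolding set_borel_measurable_def by measurable
    have "u * y - \<phi> u \<le> \<bar>y\<bar> - C" if "0 \<le> u" "u \<le> 1" for u
    proof -
      have "u * y \<le> 1 * \<bar>y\<bar>"
        using that mult_left_mono[OF abs_ge_self, of u y] mult_right_mono[of u 1 "\<bar>y\<bar>"] by simp
      with bdd[OF that] show ?thesis by simp
    qed
    then show "AE u in lborel. u \<in> {0..1} \<longrightarrow>
        norm (N_integrand \<phi> v y u) \<le> norm (exp (\<bar>y\<bar> - C) * u powr (v - 1))"
      by (auto simp: N_integrand_def abs_mult intro!: mult_right_mono)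
  qed
  then have "set_integrable lborel ({0..1} \<union> {1..}) (N_integrand \<phi> v y)"
    using int by (rule set_integrable_Un) auto
  then have "set_integrable lborel {0<..} (N_integrand \<phi> v y)"
    by (rule set_integrable_subset) auto
  then show ?thesis
    unfolding N_nn_def set_integrable_def integrable_iff_bounded
    by (simp add: abs_mult N_integrand_def)
qed

lemma N_nn_scale:
  assumes [measurable]: "\<phi> \<in> borel_measurable borel" and q: "0 < q"
  shows "(\<integral>\<^sup>+u. ennreal (indicator {0<..} u * (exp (q * u * y - \<phi> (q * u)) * u powr (v - 1))) \<partial>lborel)
         = ennreal (q powr - v) * N_nn \<phi> v y"
proof -
  have "N_nn \<phi> v y = ennreal q * (\<integral>\<^sup>+u. ennreal (indicator {0<..} (q * u) * N_integrand \<phi> v y (q * u)) \<partial>lborel)"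
    unfolding N_nn_def using q by (subst nn_integral_real_affine[where c = q and t = 0]) auto
  also have "\<dots> = ennreal q * (\<integral>\<^sup>+u. ennreal (q powr (v - 1)) *
      ennreal (indicator {0<..} u * (exp (q * u * y - \<phi> (q * u)) * u powr (v - 1))) \<partial>lborel)"
    using q by (intro arg_cong2[where f = "(*)"] nn_integral_cong refl)
      (auto simp: N_integrand_def powr_mult ennreal_mult'[symmetric] zero_less_mult_iff
        split: split_indicator)
  also have "\<dots> = ennreal (q * q powr (v - 1)) *
      (\<integral>\<^sup>+u. ennreal (indicator {0<..} u * (exp (q * u * y - \<phi> (q * u)) * u powr (v - 1))) \<partial>lborel)"
    using q by (subst nn_integral_cmult) (auto simp: ennreal_mult mult.assoc)
  also have "q * q powr (v - 1) = q powr v"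
    using q by (simp add: powr_diff)
  finally show ?thesis
    using q by (simp add: mult.assoc[symmetric] ennreal_mult[symmetric] powr_add[symmetric])
qed

text \<open>
  The kernel of the autoregression multiplies \<open>N\<close> by \<open>q\<^bsup>-v\<^esup>\<close>. The identity holds for every \<open>y\<close>,
  including those at which both sides are infinite.
\<close>

lemma (in prob_space) nn_integral_N_nn_step:
  fixes Y :: "'a \<Rightarrow> real"
  assumes Y [measurable]: "random_variable borel Y"
    and exp: "\<And>u. 0 \<le> u \<Longrightarrow> integrable M (\<lambda>\<omega>. exp (u * Y \<omega>))"
    and log: "integrable M (\<lambda>\<omega>. ln (1 + \<bar>Y \<omega>\<bar>))"
    and q: "0 < q" "q < 1"
  defines "\<phi> \<equiv> cumulant_series q M Y"
  shows "(\<integral>\<^sup>+\<omega>. N_nn \<phi> v (q * y + Y \<omega>) \<partial>M) = ennreal (q powr - v) * N_nn \<phi> v y"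
proof -
  have [measurable]: "\<phi> \<in> borel_measurable borel"
    unfolding \<phi>_def by (rule borel_measurable_cumulant_series) fact
  interpret pair_sigma_finite M lborel ..
  have "(\<integral>\<^sup>+\<omega>. N_nn \<phi> v (q * y + Y \<omega>) \<partial>M)
      = (\<integral>\<^sup>+u. (\<integral>\<^sup>+\<omega>. ennreal (indicator {0<..} u * N_integrand \<phi> v (q * y + Y \<omega>) u) \<partial>M) \<partial>lborel)"
    unfolding N_nn_def by (subst Fubini') simp_all
  also have "\<dots> = (\<integral>\<^sup>+u. ennreal (indicator {0<..} u * (exp (q * u * y - \<phi> (q * u)) * u powr (v - 1))) \<partial>lborel)"
  proof (intro nn_integral_cong)
    fix u :: real
    show "(\<integral>\<^sup>+\<omega>. ennreal (indicator {0<..} u * N_integrand \<phi> v (q * y + Y \<omega>) u) \<partial>M)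
        = ennreal (indicator {0<..} u * (exp (q * u * y - \<phi> (q * u)) * u powr (v - 1)))"
    proof (cases "0 < u")
      case True
      then have u: "0 \<le> u" by simp
      let ?c = "exp (u * (q * y) - \<phi> u) * u powr (v - 1)"
      have "(\<integral>\<^sup>+\<omega>. ennreal (indicator {0<..} u * N_integrand \<phi> v (q * y + Y \<omega>) u) \<partial>M)
          = (\<integral>\<^sup>+\<omega>. ennreal ?c * ennreal (exp (u * Y \<omega>)) \<partial>M)"
        using True by (intro nn_integral_cong)
          (simp add: N_integrand_def ennreal_mult[symmetric] exp_add[symmetric] exp_diff algebra_simps)
      also have "\<dots> = ennreal ?c * ennreal (expectation (\<lambda>\<omega>. exp (u * Y \<omega>)))"
        using exp[OF u] by (simp add: nn_integral_cmult nn_integral_eq_integral)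
      also have "expectation (\<lambda>\<omega>. exp (u * Y \<omega>)) = exp (cumulant M Y u)"
        unfolding cumulant_def using expectation_exp_pos[OF exp[OF u]] by simp
      also have "ennreal ?c * ennreal (exp (cumulant M Y u))
          = ennreal (exp (u * (q * y) - \<phi> u + cumulant M Y u) * u powr (v - 1))"
        by (simp add: ennreal_mult[symmetric] exp_add)
      also have "u * (q * y) - \<phi> u + cumulant M Y u = q * u * y - \<phi> (q * u)"
        unfolding \<phi>_def using cumulant_series_rec[OF Y exp log q u] by simp
      finally show ?thesis using True by simp
    qed simp
  qed
  also have "\<dots> = ennreal (q powr - v) * N_nn \<phi> v y"
    using q by (intro N_nn_scale) auto
  finally show ?thesis .
qed

section \<open>The Markov property\<close>

lemma ar1_cong:
  assumes "\<And>i. i \<in> {1..n} \<Longrightarrow> \<eta> i \<omega> = \<zeta> i \<omega>'"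
  shows "ar1 lam x \<eta> n \<omega> = ar1 lam x \<zeta> n \<omega>'"
  using assms by (induction n) auto

lemma borel_measurable_ar1:
  assumes "\<And>i. i \<in> {1..n} \<Longrightarrow> \<eta> i \<in> borel_measurable M"
  shows "ar1 lam x \<eta> n \<in> borel_measurable M"
  using assms by (induction n) auto

lemma space_natural_filtration [simp]: "space (natural_filtration M X n) = space M"
  unfolding natural_filtration_def by (rule space_measure_of) auto

lemma sets_natural_filtration:
  "sets (natural_filtration M X n)
     = sigma_sets (space M) {X i -` A \<inter> space M | i A. i \<le> n \<and> A \<in> sets borel}"
  unfolding natural_filtration_def by (rule sets_measure_of) auto

lemma measurable_natural_filtration:
  "i \<le> n \<Longrightarrow> X i \<in> borel_measurable (natural_filtration M X n)"
  by (rule measurableI) (auto simp: sets_natural_filtration intro!: sigma_sets.Basic)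

lemma filtration_natural_filtration: "filtration (space M) (natural_filtration M X)"
  by standard (simp, unfold sets_natural_filtration, intro sigma_sets_mono', blast intro: order_trans)

lemma natural_filtration_least:
  assumes "space N = space M" "\<And>i. i \<le> n \<Longrightarrow> X i \<in> borel_measurable N"
  shows "sets (natural_filtration M X n) \<subseteq> sets N"
  unfolding sets_natural_filtration assms(1)[symmetric]
  using assms(2) by (intro sets.sigma_sets_subset) (auto intro: measurable_sets)

lemma (in prob_space) nn_integral_indep_var:
  assumes ind: "indep_var S W T V"
    and g [measurable]: "case_prod g \<in> borel_measurable (S \<Otimes>\<^sub>M T)"
  shows "(\<integral>\<^sup>+\<omega>. g (W \<omega>) (V \<omega>) \<partial>M) = (\<integral>\<^sup>+\<omega>. (\<integral>\<^sup>+\<omega>'. g (W \<omega>) (V \<omega>') \<partial>M) \<partial>M)"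
proof -
  have W [measurable]: "W \<in> measurable M S" and V [measurable]: "V \<in> measurable M T"
    using ind by (auto dest: indep_var_rv1 indep_var_rv2)
  interpret V: prob_space "distr M T V" by (rule prob_space_distr) fact
  have "(\<integral>\<^sup>+\<omega>. g (W \<omega>) (V \<omega>) \<partial>M)
      = (\<integral>\<^sup>+p. case_prod g p \<partial>distr M (S \<Otimes>\<^sub>M T) (\<lambda>\<omega>. (W \<omega>, V \<omega>)))"
    by (subst nn_integral_distr) auto
  also have "distr M (S \<Otimes>\<^sub>M T) (\<lambda>\<omega>. (W \<omega>, V \<omega>)) = distr M S W \<Otimes>\<^sub>M distr M T V"
    using ind by (simp add: indep_var_distribution_eq)
  also have "(\<integral>\<^sup>+p. case_prod g p \<partial>(distr M S W \<Otimes>\<^sub>M distr M T V))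
      = (\<integral>\<^sup>+w. (\<integral>\<^sup>+z. g w z \<partial>distr M T V) \<partial>distr M S W)"
    by (subst V.nn_integral_fst[symmetric]) (auto cong: measurable_cong_sets)
  also have "\<dots> = (\<integral>\<^sup>+\<omega>. (\<integral>\<^sup>+z. g (W \<omega>) z \<partial>distr M T V) \<partial>M)"
    by (rule nn_integral_distr[OF W]) measurable
  also have "\<dots> = (\<integral>\<^sup>+\<omega>. (\<integral>\<^sup>+\<omega>'. g (W \<omega>) (V \<omega>') \<partial>M) \<partial>M)"
    using measurable_space[OF W] by (intro nn_integral_cong nn_integral_distr[OF V]) auto
  finally show ?thesis .
qed

text \<open>
  The Markov property in integrated form. The past up to time \<open>n\<close> is a function of the innovations
  with indices in \<open>{1..n}\<close>, hence independent of \<open>\<eta> (Suc n)\<close>.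
\<close>

lemma (in prob_space) ar1_markov:
  fixes f :: "real \<Rightarrow> ennreal"
  assumes indep: "indep_vars (\<lambda>_. borel) \<eta> {1..}"
    and f [measurable]: "f \<in> borel_measurable borel"
    and A: "A \<in> sets (natural_filtration M (ar1 lam x \<eta>) n)"
  shows "(\<integral>\<^sup>+\<omega>. f (ar1 lam x \<eta> (Suc n) \<omega>) * indicator A \<omega> \<partial>M)
       = (\<integral>\<^sup>+\<omega>. (\<integral>\<^sup>+\<omega>'. f (lam * ar1 lam x \<eta> n \<omega> + \<eta> (Suc n) \<omega>') \<partial>M) * indicator A \<omega> \<partial>M)"
proof -
  \<comment> \<open>The single innovation \<open>\<eta> (Suc n)\<close> is packed as a one-point family \<open>V\<close>, because \<open>indep_var\<close>
      requires both variables to have the same type.\<close>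
  define S where "S = PiM {1..n} (\<lambda>_. borel :: real measure)"
  define T where "T = PiM {Suc n} (\<lambda>_. borel :: real measure)"
  define W where "W = (\<lambda>\<omega>. \<lambda>i\<in>{1..n}. \<eta> i \<omega>)"
  define V where "V = (\<lambda>\<omega>. \<lambda>i\<in>{Suc n}. \<eta> i \<omega>)"
  \<comment> \<open>The recursion run on the coordinate process, so that \<open>h i \<circ> W\<close> is the autoregression at time \<open>i \<le> n\<close>.\<close>
  define h where "h = ar1 lam x (\<lambda>i w. w i)"
  have ind: "indep_var S W T V"
    unfolding S_def W_def T_def V_def by (rule indep_var_restrict[OF indep]) auto
  have W [measurable]: "W \<in> measurable M S"
    using ind by (rule indep_var_rv1)
  have \<eta> [measurable]: "\<eta> (Suc n) \<in> borel_measurable M"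
    using indep by (auto simp: indep_vars_def)
  have h [measurable]: "h i \<in> borel_measurable S" if "i \<le> n" for i
    unfolding h_def S_def using that by (intro borel_measurable_ar1) auto
  have hW: "ar1 lam x \<eta> i \<omega> = h i (W \<omega>)" if "i \<le> n" for i \<omega>
    unfolding h_def W_def using that by (intro ar1_cong) auto
  have "sets (natural_filtration M (ar1 lam x \<eta>) n) \<subseteq> sets (vimage_algebra (space M) W S)"
  proof (rule natural_filtration_least)
    fix i assume i: "i \<le> n"
    have "W \<in> measurable (vimage_algebra (space M) W S) S"
      using measurable_space[OF W] by (intro measurable_vimage_algebra1) auto
    from measurable_compose[OF this h[OF i]] hW[OF i]
    show "ar1 lam x \<eta> i \<in> borel_measurable (vimage_algebra (space M) W S)"
      by (simp cong: measurable_cong)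
  qed simp
  with A have "A \<in> sets (vimage_algebra (space M) W S)" by auto
  then obtain B where [measurable]: "B \<in> sets S" and AB: "A = W -` B \<inter> space M"
    using measurable_space[OF W] by (subst (asm) sets_vimage_algebra2) auto
  have [measurable]: "h n \<in> borel_measurable S" by (rule h) simp
  have [measurable]: "(\<lambda>w. w (Suc n)) \<in> borel_measurable T"
    unfolding T_def by measurable
  have "(\<integral>\<^sup>+\<omega>. f (ar1 lam x \<eta> (Suc n) \<omega>) * indicator A \<omega> \<partial>M)
      = (\<integral>\<^sup>+\<omega>. f (lam * h n (W \<omega>) + V \<omega> (Suc n)) * indicator B (W \<omega>) \<partial>M)"
    by (intro nn_integral_cong) (auto simp: AB hW V_def split: split_indicator)
  also have "\<dots> = (\<integral>\<^sup>+\<omega>. (\<integral>\<^sup>+\<omega>'. f (lam * h n (W \<omega>) + V \<omega>' (Suc n)) * indicator B (W \<omega>) \<partial>M) \<partial>M)"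
    by (rule nn_integral_indep_var[OF ind]) measurable
  also have "\<dots> = (\<integral>\<^sup>+\<omega>. (\<integral>\<^sup>+\<omega>'. f (lam * ar1 lam x \<eta> n \<omega> + \<eta> (Suc n) \<omega>') \<partial>M) * indicator A \<omega> \<partial>M)"
    by (intro nn_integral_cong) (auto simp: AB hW V_def split: split_indicator)
  finally show ?thesis .
qed

section \<open>The martingale\<close>

text \<open>
  For an extended nonnegative process, conservation of the integral over the events of the filtration
  in one step, together with a finite initial expectation, gives finiteness almost everywhere and the
  martingale property of the real-valued version.
\<close>

lemma (in prob_space) martingale_enn2real:
  fixes Z :: "nat \<Rightarrow> 'a \<Rightarrow> ennreal"
  assumes filt: "filtration (space M) F" and sub: "\<And>n. subalgebra M (F n)"
    and Z: "\<And>n. Z n \<in> borel_measurable (F n)"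
    and fin: "(\<integral>\<^sup>+\<omega>. Z 0 \<omega> \<partial>M) < \<infinity>"
    and step: "\<And>n A. A \<in> sets (F n) \<Longrightarrow>
        (\<integral>\<^sup>+\<omega>. Z (Suc n) \<omega> * indicator A \<omega> \<partial>M) = (\<integral>\<^sup>+\<omega>. Z n \<omega> * indicator A \<omega> \<partial>M)"
  shows "martingale M F (\<lambda>n \<omega>. enn2real (Z n \<omega>))"
proof -
  have ZM [measurable]: "Z n \<in> borel_measurable M" for n
    using Z sub by (rule measurable_from_subalg[rotated])
  have eq: "(\<integral>\<^sup>+\<omega>. Z n \<omega> * indicator A \<omega> \<partial>M) = (\<integral>\<^sup>+\<omega>. Z m \<omega> * indicator A \<omega> \<partial>M)"
    if "m \<le> n" "A \<in> sets (F m)" for m n A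
    using that(1)
  proof (induction n rule: dec_induct)
    case (step k)
    have "A \<in> sets (F k)"
      using filtration.sets_F_mono[OF filt step(1)] that(2) by auto
    with step show ?case by (simp add: assms(5))
  qed simp
  have total: "(\<integral>\<^sup>+\<omega>. Z n \<omega> \<partial>M) < \<infinity>" for n
  proof -
    have "space M \<in> sets (F 0)"
      using sub[of 0] sets.top[of "F 0"] by (simp add: subalgebra_def)
    from eq[OF _ this, of n] have "(\<integral>\<^sup>+\<omega>. Z n \<omega> \<partial>M) = (\<integral>\<^sup>+\<omega>. Z 0 \<omega> \<partial>M)"
      by (simp add: nn_integral_set_ennreal[symmetric] cong: nn_integral_cong)
    with fin show ?thesis by simp
  qed
  have AEfin: "AE \<omega> in M. Z n \<omega> < \<infinity>" for n
    using nn_integral_PInf_AE[OF ZM, of n] total[of n] by (auto simp: less_top)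
  have nn: "(\<integral>\<^sup>+\<omega>. ennreal (enn2real (Z n \<omega>)) * indicator A \<omega> \<partial>M) = (\<integral>\<^sup>+\<omega>. Z n \<omega> * indicator A \<omega> \<partial>M)" for n A
    using AEfin[of n] by (intro nn_integral_cong_AE) (auto simp: less_top)
  have int: "integrable M (\<lambda>\<omega>. enn2real (Z n \<omega>))" for n
    using nn[of n UNIV] total[of n] by (intro integrableI_nonneg) auto
  have set_int: "(LINT \<omega>:A|M. enn2real (Z n \<omega>)) = enn2real (\<integral>\<^sup>+\<omega>. Z n \<omega> * indicator A \<omega> \<partial>M)"
    if "A \<in> sets M" for n A
  proof -
    have "(LINT \<omega>:A|M. enn2real (Z n \<omega>))
        = enn2real (\<integral>\<^sup>+\<omega>. ennreal (indicator A \<omega> * enn2real (Z n \<omega>)) \<partial>M)"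
      unfolding set_lebesgue_integral_def using that by (subst integral_eq_nn_integral) auto
    also have "(\<integral>\<^sup>+\<omega>. ennreal (indicator A \<omega> * enn2real (Z n \<omega>)) \<partial>M)
        = (\<integral>\<^sup>+\<omega>. ennreal (enn2real (Z n \<omega>)) * indicator A \<omega> \<partial>M)"
      by (intro nn_integral_cong) (auto split: split_indicator)
    finally show ?thesis by (simp add: nn)
  qed
  have "AE \<omega> in M. real_cond_exp M (F m) (\<lambda>\<omega>. enn2real (Z n \<omega>)) \<omega> = enn2real (Z m \<omega>)"
    if "m \<le> n" for m n
  proof -
    interpret finite_measure_subalgebra M "F m"
      by standard (rule sub)
    show ?thesis
    proof (rule real_cond_exp_charact)
      fix A assume A: "A \<in> sets (F m)"
      then have "A \<in> sets M" using sub[of m] by (auto simp: subalgebra_def)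
      then show "(LINT \<omega>:A|M. enn2real (Z n \<omega>)) = (LINT \<omega>:A|M. enn2real (Z m \<omega>))"
        by (simp add: set_int eq[OF that A])
    next
      show "(\<lambda>\<omega>. enn2real (Z m \<omega>)) \<in> borel_measurable (F m)"
        using Z[of m] by measurable
    qed (rule int)+
  qed
  then show ?thesis
    unfolding martingale_def using filt sub int Z by auto
qed

theorem proposition1:
  fixes M :: "'a measure" and \<eta> :: "nat \<Rightarrow> 'a \<Rightarrow> real"
    and lam x v :: real and D :: "real set"
    and X :: "nat \<Rightarrow> 'a \<Rightarrow> real" and \<phi> :: "real \<Rightarrow> real"
  defines "X \<equiv> ar1 lam x \<eta>"
    and "\<phi> \<equiv> cumulant_series lam M (\<eta> 1)"
  assumes "prob_space M"
    and indep: "prob_space.indep_vars M (\<lambda>_. borel) \<eta> {1..}"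
    and ident: "\<And>n. n \<ge> 1 \<Longrightarrow> distr M borel (\<eta> n) = distr M borel (\<eta> 1)"
    and lam: "0 < lam" "lam < 1"
    and D_init: "x \<in> D"
    and D_state: "\<And>n. AE \<omega> in M. X n \<omega> \<in> D"
    and v: "v > 0"
    and exp_moments: "\<And>u. u \<ge> 0 \<Longrightarrow> integrable M (\<lambda>\<omega>. exp (u * \<eta> 1 \<omega>))"
    and log_moment: "integrable M (\<lambda>\<omega>. ln (1 + \<bar>\<eta> 1 \<omega>\<bar>))"
    and int_at_infinity: "\<And>y. y \<in> D \<Longrightarrow> set_integrable lborel {1..} (N_integrand \<phi> v y)"
  shows "martingale M (natural_filtration M X)
           (\<lambda>n \<omega>. lam powr (v * real n) * N_fun \<phi> v (X n \<omega>))"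
proof -
  interpret prob_space M by fact
  have \<eta> [measurable]: "random_variable borel (\<eta> n)" if "1 \<le> n" for n
    using indep that by (auto simp: indep_vars_def)
  have \<eta>1 [measurable]: "random_variable borel (\<eta> 1)" by (rule \<eta>) simp
  have \<phi> [measurable]: "\<phi> \<in> borel_measurable borel"
    unfolding \<phi>_def by (rule borel_measurable_cumulant_series) fact
  have N [measurable]: "N_nn \<phi> v \<in> borel_measurable borel"
    by (rule borel_measurable_N_nn) fact
  have X [measurable]: "X n \<in> borel_measurable M" for n
    unfolding X_def by (intro borel_measurable_ar1 \<eta>) auto
  define Z where "Z n \<omega> = ennreal (lam powr (v * real n)) * N_nn \<phi> v (X n \<omega>)" for n \<omega>
  have "martingale M (natural_filtration M X) (\<lambda>n \<omega>. enn2real (Z n \<omega>))"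
  proof (rule martingale_enn2real)
    show "filtration (space M) (natural_filtration M X)"
      by (rule filtration_natural_filtration)
    show "subalgebra M (natural_filtration M X n)" for n
      using natural_filtration_least[of M M n X] by (simp add: subalgebra_def X)
    show "Z n \<in> borel_measurable (natural_filtration M X n)" for n
    proof -
      have [measurable]: "X n \<in> borel_measurable (natural_filtration M X n)"
        by (rule measurable_natural_filtration) simp
      show ?thesis unfolding Z_def by measurable
    qed
    obtain C where "\<And>u. 0 \<le> u \<Longrightarrow> u \<le> 1 \<Longrightarrow> C \<le> \<phi> u"
      unfolding \<phi>_def using cumulant_series_bounded_below[OF \<eta>1 exp_moments log_moment lam] by metis
    then have "N_nn \<phi> v x < \<infinity>"
      using N_nn_finite[OF \<phi> v _ int_at_infinity[OF D_init]] by blast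
    then show "(\<integral>\<^sup>+\<omega>. Z 0 \<omega> \<partial>M) < \<infinity>"
      using lam by (simp add: Z_def X_def emeasure_space_1)
  next
    fix n A assume A: "A \<in> sets (natural_filtration M X n)"
    then have [measurable]: "A \<in> sets M"
      using natural_filtration_least[of M M n X] X by auto
    have step: "(\<integral>\<^sup>+\<omega>'. N_nn \<phi> v (lam * y + \<eta> (Suc n) \<omega>') \<partial>M)
        = ennreal (lam powr - v) * N_nn \<phi> v y" for y
    proof -
      have "(\<integral>\<^sup>+\<omega>'. N_nn \<phi> v (lam * y + \<eta> (Suc n) \<omega>') \<partial>M)
          = (\<integral>\<^sup>+z. N_nn \<phi> v (lam * y + z) \<partial>distr M borel (\<eta> (Suc n)))"
        by (subst nn_integral_distr) auto
      also have "\<dots> = (\<integral>\<^sup>+z. N_nn \<phi> v (lam * y + z) \<partial>distr M borel (\<eta> 1))"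
        by (subst ident) auto
      also have "\<dots> = (\<integral>\<^sup>+\<omega>'. N_nn \<phi> v (lam * y + \<eta> 1 \<omega>') \<partial>M)"
        by (subst nn_integral_distr) auto
      also have "\<dots> = ennreal (lam powr - v) * N_nn \<phi> v y"
        unfolding \<phi>_def by (rule nn_integral_N_nn_step[OF \<eta>1 exp_moments log_moment lam])
      finally show ?thesis .
    qed
    have "(\<integral>\<^sup>+\<omega>. Z (Suc n) \<omega> * indicator A \<omega> \<partial>M)
        = ennreal (lam powr (v * real (Suc n))) * (\<integral>\<^sup>+\<omega>. N_nn \<phi> v (X (Suc n) \<omega>) * indicator A \<omega> \<partial>M)"
      by (simp add: Z_def nn_integral_cmult[symmetric] mult.assoc)
    also have "(\<integral>\<^sup>+\<omega>. N_nn \<phi> v (X (Suc n) \<omega>) * indicator A \<omega> \<partial>M)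
        = (\<integral>\<^sup>+\<omega>. (ennreal (lam powr - v) * N_nn \<phi> v (X n \<omega>)) * indicator A \<omega> \<partial>M)"
      unfolding X_def by (subst ar1_markov[OF indep N A[unfolded X_def]]) (simp only: step)
    also have "\<dots> = ennreal (lam powr - v) * (\<integral>\<^sup>+\<omega>. N_nn \<phi> v (X n \<omega>) * indicator A \<omega> \<partial>M)"
      by (simp add: nn_integral_cmult[symmetric] mult.assoc)
    also have "ennreal (lam powr (v * real (Suc n))) * \<dots>
        = ennreal (lam powr (v * real n)) * (\<integral>\<^sup>+\<omega>. N_nn \<phi> v (X n \<omega>) * indicator A \<omega> \<partial>M)"
      by (simp add: mult.assoc[symmetric] ennreal_mult[symmetric] powr_add[symmetric] algebra_simps)
    also have "\<dots> = (\<integral>\<^sup>+\<omega>. Z n \<omega> * indicator A \<omega> \<partial>M)"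
      by (simp add: Z_def nn_integral_cmult[symmetric] mult.assoc)
    finally show "(\<integral>\<^sup>+\<omega>. Z (Suc n) \<omega> * indicator A \<omega> \<partial>M) = (\<integral>\<^sup>+\<omega>. Z n \<omega> * indicator A \<omega> \<partial>M)" .
  qed
  also have "(\<lambda>n \<omega>. enn2real (Z n \<omega>)) = (\<lambda>n \<omega>. lam powr (v * real n) * N_fun \<phi> v (X n \<omega>))"
    by (simp add: Z_def fun_eq_iff N_fun_eq_N_nn[OF \<phi>] enn2real_mult)
  finally show ?thesis .
qed

end
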